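(* Let $n\ge1$, $r\ge1$ be integers, let $\beta\in\mathbb{Z}_n$, let $l=\gcd(n,\beta)$, and let $N_\beta$ be the number of matrices $X\in\mathrm{GL}_r(\mathbb{Z}_n)$ with $\mathrm{tr}\,X=\beta$. Then $$N_\beta=n^{r^2-1}\prod_{p\mid l}\left(\prod_{i=1}^r(1-p^{-i})+(-1)^rp^{-r(r+1)/2}(p-1)\right)\times\prod_{\substack{p\mid n\\ p\nmid l}}\left(\prod_{i=1}^r(1-p^{-i})-(-1)^rp^{-r(r+1)/2}\right),$$ where the products are over primes $p$.
   Context: $\mathbb{Z}_n=\mathbb{Z}/n\mathbb{Z}$ and $\mathrm{GL}_r(\mathbb{Z}_n)$ is the group of invertible $r\times r$ matrices over $\mathbb{Z}_n$; $\gcd(n,\beta)$ means the gcd of $n$ with any integer representative of $\beta$ (so $l=n$ when $\beta=0$). *)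

theory Defs
  imports
    "HOL-Number_Theory.Cong"
    "HOL-Computational_Algebra.Primes"
    "Jordan_Normal_Form.Matrix"
begin

text \<open>
  Elements of \<open>\<int>/n\<int>\<close> are represented by their residues in \<open>{0..<n}\<close>, as in
  \<open>residue_ring\<close> of HOL-Number_Theory. That ring is not used itself because its unit
  \<open>1\<close> lies outside the carrier \<open>{0}\<close> when \<open>n = 1\<close>; reducing the identity matrix as well
  covers \<open>n = 1\<close> (the zero ring).
\<close>

definition reduce_mat :: "nat \<Rightarrow> int mat \<Rightarrow> int mat" where
  "reduce_mat n A = map_mat (\<lambda>a. a mod int n) A"

definition residue_mat_ring :: "nat \<Rightarrow> nat \<Rightarrow> int mat ring" where
  "residue_mat_ring n r =
    \<lparr>carrier = {A \<in> carrier_mat r r. \<forall>i<r. \<forall>j<r. A $$ (i, j) \<in> {0..<int n}},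
     mult = (\<lambda>A B. reduce_mat n (A * B)),
     one = reduce_mat n (1\<^sub>m r),
     zero = 0\<^sub>m r r,
     add = (\<lambda>A B. reduce_mat n (A + B))\<rparr>"

definition GL_residues :: "nat \<Rightarrow> nat \<Rightarrow> int mat set" where
  "GL_residues n r = Units (residue_mat_ring n r)"

definition mat_trace :: "int mat \<Rightarrow> int" where
  "mat_trace A = (\<Sum>i<dim_row A. A $$ (i, i))"

lemma reduce_mat_carrier [simp]:
  "reduce_mat n A \<in> carrier_mat r s \<longleftrightarrow> A \<in> carrier_mat r s"
  by (auto simp: reduce_mat_def)

lemma reduce_mat_mult_left:
  assumes "A \<in> carrier_mat r r" "B \<in> carrier_mat r r"
  shows "reduce_mat n (reduce_mat n A * B) = reduce_mat n (A * B)"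
proof (rule eq_matI)
  fix i j assume "i < dim_row (reduce_mat n (A * B))" "j < dim_col (reduce_mat n (A * B))"
  hence ij: "i < r" "j < r" using assms by (auto simp: reduce_mat_def)
  have "(\<Sum>k = 0..<r. (A $$ (i,k) mod int n) * B $$ (k,j)) mod int n
      = (\<Sum>k = 0..<r. A $$ (i,k) * B $$ (k,j)) mod int n"
    by (subst (1 2) mod_sum_eq [symmetric]) (simp add: mod_mult_left_eq)
  thus "reduce_mat n (reduce_mat n A * B) $$ (i,j) = reduce_mat n (A * B) $$ (i,j)"
    using ij assms by (auto simp: reduce_mat_def scalar_prod_def)
qed (use assms in \<open>auto simp: reduce_mat_def\<close>)

lemma reduce_mat_mult_right:
  assumes "A \<in> carrier_mat r r" "B \<in> carrier_mat r r"
  shows "reduce_mat n (A * reduce_mat n B) = reduce_mat n (A * B)"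
proof (rule eq_matI)
  fix i j assume "i < dim_row (reduce_mat n (A * B))" "j < dim_col (reduce_mat n (A * B))"
  hence ij: "i < r" "j < r" using assms by (auto simp: reduce_mat_def)
  have "(\<Sum>k = 0..<r. A $$ (i,k) * (B $$ (k,j) mod int n)) mod int n
      = (\<Sum>k = 0..<r. A $$ (i,k) * B $$ (k,j)) mod int n"
    by (subst (1 2) mod_sum_eq [symmetric]) (simp add: mod_mult_right_eq)
  thus "reduce_mat n (A * reduce_mat n B) $$ (i,j) = reduce_mat n (A * B) $$ (i,j)"
    using ij assms by (auto simp: reduce_mat_def scalar_prod_def)
qed (use assms in \<open>auto simp: reduce_mat_def\<close>)

lemma reduce_mat_add:
  assumes "A \<in> carrier_mat r s" "B \<in> carrier_mat r s"
  shows "reduce_mat n (reduce_mat n A + B) = reduce_mat n (A + B)"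
    and "reduce_mat n (A + reduce_mat n B) = reduce_mat n (A + B)"
  using assms by (auto simp: reduce_mat_def mod_simps intro!: eq_matI)

lemma reduce_mat_id:
  assumes "A \<in> carrier (residue_mat_ring n r)"
  shows "reduce_mat n A = A"
  using assms by (auto simp: residue_mat_ring_def reduce_mat_def intro!: eq_matI)

lemma reduce_mat_closed:
  assumes "n > 0" "A \<in> carrier_mat r r"
  shows "reduce_mat n A \<in> carrier (residue_mat_ring n r)"
  using assms by (auto simp: residue_mat_ring_def reduce_mat_def)

lemma ring_residue_mat_ring:
  assumes "n > 0"
  shows "ring (residue_mat_ring n r)"
proof (rule ringI)
  let ?R = "residue_mat_ring n r"
  note D = residue_mat_ring_def
  have car: "A \<in> carrier_mat r r" if "A \<in> carrier ?R" for A
    using that by (simp add: D)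
  show "abelian_group ?R"
  proof (rule abelian_groupI)
    fix A B assume "A \<in> carrier ?R" "B \<in> carrier ?R"
    thus "A \<oplus>\<^bsub>?R\<^esub> B \<in> carrier ?R"
      using reduce_mat_closed[OF assms, of "A + B" r] car[of A] car[of B] by (simp add: D)
  next
    show "\<zero>\<^bsub>?R\<^esub> \<in> carrier ?R" using assms by (auto simp: D)
  next
    fix A B C assume "A \<in> carrier ?R" "B \<in> carrier ?R" "C \<in> carrier ?R"
    thus "A \<oplus>\<^bsub>?R\<^esub> B \<oplus>\<^bsub>?R\<^esub> C = A \<oplus>\<^bsub>?R\<^esub> (B \<oplus>\<^bsub>?R\<^esub> C)"
      using car[of A] car[of B] car[of C]
        reduce_mat_add(1)[of "A + B" r r C n] reduce_mat_add(2)[of A r r "B + C" n]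
      by (simp add: D assoc_add_mat[of A r r B C])
  next
    fix A B assume "A \<in> carrier ?R" "B \<in> carrier ?R"
    thus "A \<oplus>\<^bsub>?R\<^esub> B = B \<oplus>\<^bsub>?R\<^esub> A"
      using car[of A] car[of B] by (simp add: D comm_add_mat[of A r r B])
  next
    fix A assume A: "A \<in> carrier ?R"
    show "\<zero>\<^bsub>?R\<^esub> \<oplus>\<^bsub>?R\<^esub> A = A"
      using reduce_mat_id[OF A] car[OF A] by (simp add: D)
    show "\<exists>B\<in>carrier ?R. B \<oplus>\<^bsub>?R\<^esub> A = \<zero>\<^bsub>?R\<^esub>"
    proof
      show "reduce_mat n (- A) \<in> carrier ?R"
        using reduce_mat_closed[OF assms, of "- A" r] car[OF A] by simp
      show "reduce_mat n (- A) \<oplus>\<^bsub>?R\<^esub> A = \<zero>\<^bsub>?R\<^esub>"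
        using reduce_mat_add(1)[of "- A" r r A n] car[OF A]
        by (auto simp: D reduce_mat_def intro!: eq_matI)
    qed
  qed
  show "Group.monoid ?R"
  proof (rule Group.monoidI)
    fix A B assume "A \<in> carrier ?R" "B \<in> carrier ?R"
    thus "A \<otimes>\<^bsub>?R\<^esub> B \<in> carrier ?R"
      using reduce_mat_closed[OF assms, of "A * B" r] car[of A] car[of B] mult_carrier_mat[of A r r B r] by (simp add: D)
  next
    show "\<one>\<^bsub>?R\<^esub> \<in> carrier ?R"
      using reduce_mat_closed[OF assms, of "1\<^sub>m r" r] by (simp add: D)
  next
    fix A B C assume "A \<in> carrier ?R" "B \<in> carrier ?R" "C \<in> carrier ?R"
    thus "A \<otimes>\<^bsub>?R\<^esub> B \<otimes>\<^bsub>?R\<^esub> C = A \<otimes>\<^bsub>?R\<^esub> (B \<otimes>\<^bsub>?R\<^esub> C)"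
      using car[of A] car[of B] car[of C] reduce_mat_mult_left[of "A * B" r C n]
        reduce_mat_mult_right[of A r "B * C" n]
        mult_carrier_mat[of A r r B r] mult_carrier_mat[of B r r C r]
      by (simp add: D assoc_mult_mat[of A r r B r C r])
  next
    fix A assume A: "A \<in> carrier ?R"
    show "\<one>\<^bsub>?R\<^esub> \<otimes>\<^bsub>?R\<^esub> A = A" "A \<otimes>\<^bsub>?R\<^esub> \<one>\<^bsub>?R\<^esub> = A"
      using reduce_mat_id[OF A] car[OF A] reduce_mat_mult_left[of "1\<^sub>m r" r A n]
        reduce_mat_mult_right[of A r "1\<^sub>m r" n] by (simp_all add: D)
  qed
  fix A B C assume "A \<in> carrier ?R" "B \<in> carrier ?R" "C \<in> carrier ?R"
  hence c: "A \<in> carrier_mat r r" "B \<in> carrier_mat r r" "C \<in> carrier_mat r r"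
    using car by auto
  show "(A \<oplus>\<^bsub>?R\<^esub> B) \<otimes>\<^bsub>?R\<^esub> C = A \<otimes>\<^bsub>?R\<^esub> C \<oplus>\<^bsub>?R\<^esub> B \<otimes>\<^bsub>?R\<^esub> C"
    using c reduce_mat_mult_left[of "A + B" r C n] reduce_mat_add(1)[of "A * C" r r "B * C" n]
      reduce_mat_add(2)[of "reduce_mat n (A * C)" r r "B * C" n]
      mult_carrier_mat[of A r r C r] mult_carrier_mat[of B r r C r]
    by (simp add: D add_mult_distrib_mat[of A r r B C r])
  show "C \<otimes>\<^bsub>?R\<^esub> (A \<oplus>\<^bsub>?R\<^esub> B) = C \<otimes>\<^bsub>?R\<^esub> A \<oplus>\<^bsub>?R\<^esub> C \<otimes>\<^bsub>?R\<^esub> B"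
    using c reduce_mat_mult_right[of C r "A + B" n] reduce_mat_add(1)[of "C * A" r r "C * B" n]
      reduce_mat_add(2)[of "reduce_mat n (C * A)" r r "C * B" n]
      mult_carrier_mat[of C r r A r] mult_carrier_mat[of C r r B r]
    by (simp add: D mult_add_distrib_mat[of C r r A r B])
qed

end

theory Submission
  imports Defs "Jordan_Normal_Form.Determinant"
begin

text \<open>
  By the Chinese remainder theorem and by lifting from \<open>n\<close> to \<open>n p\<close> for primes \<open>p\<close> dividing \<open>n\<close>
  (invertibility only depends on the residue mod \<open>n\<close>, and the trace of the added digit matrix is
  equidistributed), the count reduces to \<open>n = p\<close> prime. There, write an \<open>(r+1) \<times> (r+1)\<close> matrix as
  \<open>A\<close> bordered by a column \<open>b\<close>, a row \<open>w\<close> and a corner \<open>c\<close>, and sum over \<open>b\<close> first. The determinant is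
  linear in the last column; if \<open>w \<noteq> 0\<close>, then the number of good \<open>b\<close> does not depend on \<open>c\<close>, hence
  contributes a constant \<open>K\<close> to every trace \<open>t\<close>; if \<open>w = 0\<close>, then \<open>b\<close> is free and the
  condition is \<open>c \<noteq> 0\<close> and \<open>A\<close> invertible. With \<open>N\<^sub>r(t)\<close> the number of invertible matrices of trace \<open>t\<close> and \<open>G\<^sub>r\<close>
  their total number, this reads \<open>N\<^sub>r\<^sub>+\<^sub>1(t) = K + p\<^sup>r (G\<^sub>r - N\<^sub>r(t))\<close>. Prescribing the corner
  \<open>c = 1\<close> instead of the trace gives \<open>K + p\<^sup>r G\<^sub>r\<close>, and this number is
  \<open>p\<^sup>2\<^sup>r G\<^sub>r\<close> by the Schur complement \<open>A - b w\<close>. So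
  \<open>N\<^sub>r\<^sub>+\<^sub>1(t) = p\<^sup>2\<^sup>r G\<^sub>r - p\<^sup>r N\<^sub>r(t)\<close>, and summing over \<open>t\<close> yields \<open>G\<^sub>r\<close> as well.
\<close>

section \<open>Rectangular matrices of residues\<close>

text \<open>For \<open>a = b = r\<close> this is the carrier of \<open>residue_mat_ring n r\<close>;
  the rectangular version also covers the border columns and rows.\<close>

definition residue_mats :: "nat \<Rightarrow> nat \<Rightarrow> nat \<Rightarrow> int mat set" where
  "residue_mats n a b = {A \<in> carrier_mat a b. \<forall>i<a. \<forall>j<b. A $$ (i, j) \<in> {0..<int n}}"

lemma residue_matsD:
  assumes "A \<in> residue_mats n a b"
  shows "A \<in> carrier_mat a b" "dim_row A = a" "dim_col A = b"
    and "\<And>i j. i < a \<Longrightarrow> j < b \<Longrightarrow> 0 \<le> A $$ (i, j) \<and> A $$ (i, j) < int n"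
  using assms by (auto simp: residue_mats_def)

lemma card_residue_mats: "card (residue_mats n a b) = n ^ (a * b)"
  and finite_residue_mats [simp]: "finite (residue_mats n a b)"
proof -
  let ?I = "{..<a} \<times> {..<b}"
  let ?F = "PiE ?I (\<lambda>_. {0..<int n})"
  have "bij_betw (\<lambda>f. mat a b f) ?F (residue_mats n a b)"
    by (rule bij_betw_byWitness[where f' = "\<lambda>A. restrict (\<lambda>ij. A $$ ij) ?I"])
      (force simp: residue_mats_def PiE_iff extensional_def intro!: eq_matI)+
  moreover have "finite ?F" by (intro finite_PiE) auto
  moreover have "card ?F = n ^ (a * b)" by (subst card_PiE) auto
  ultimately show "card (residue_mats n a b) = n ^ (a * b)" "finite (residue_mats n a b)"
    using bij_betw_same_card bij_betw_finite by metis+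
qed

lemma reduce_mat_dim [simp]: "dim_row (reduce_mat n A) = dim_row A" "dim_col (reduce_mat n A) = dim_col A"
  by (auto simp: reduce_mat_def)

lemma reduce_mat_index [simp]:
  "i < dim_row A \<Longrightarrow> j < dim_col A \<Longrightarrow> reduce_mat n A $$ (i, j) = A $$ (i, j) mod int n"
  by (auto simp: reduce_mat_def)

lemma reduce_mat_in_residue_mats:
  "n > 0 \<Longrightarrow> A \<in> carrier_mat a b \<Longrightarrow> reduce_mat n A \<in> residue_mats n a b"
  by (auto simp: residue_mats_def reduce_mat_def)

lemma bij_betw_shift_residue_mats:
  assumes "n > 0" "Z \<in> carrier_mat a b"
  shows "bij_betw (\<lambda>Y. reduce_mat n (Y + Z)) (residue_mats n a b) (residue_mats n a b)"
proof (rule bij_betw_byWitness[where f' = "\<lambda>Y. reduce_mat n (Y - Z)"])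
  show "\<forall>Y\<in>residue_mats n a b. reduce_mat n (reduce_mat n (Y + Z) - Z) = Y"
  proof (intro ballI eq_matI)
    fix Y i j assume Y: "Y \<in> residue_mats n a b" and "i < dim_row Y" "j < dim_col Y"
    thus "reduce_mat n (reduce_mat n (Y + Z) - Z) $$ (i, j) = Y $$ (i, j)"
      using residue_matsD[OF Y] assms(2) by (simp add: mod_diff_left_eq)
  qed (use assms(2) in \<open>auto dest: residue_matsD\<close>)
  show "\<forall>Y\<in>residue_mats n a b. reduce_mat n (reduce_mat n (Y - Z) + Z) = Y"
  proof (intro ballI eq_matI)
    fix Y i j assume Y: "Y \<in> residue_mats n a b" and "i < dim_row Y" "j < dim_col Y"
    thus "reduce_mat n (reduce_mat n (Y - Z) + Z) $$ (i, j) = Y $$ (i, j)"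
      using residue_matsD[OF Y] assms(2) by (simp add: mod_add_left_eq)
  qed (use assms(2) in \<open>auto dest: residue_matsD\<close>)
qed (use assms in \<open>auto intro!: reduce_mat_in_residue_mats dest: residue_matsD\<close>)

section \<open>Fibres of linear functionals mod \<open>n\<close>\<close>

lemma card_Collect_eq_sum: "finite S \<Longrightarrow> card {x \<in> S. P x} = (\<Sum>x\<in>S. of_bool (P x))"
  by (simp add: Int_def)

lemma sum_cong_residue:
  assumes "n > 0"
  shows "(\<Sum>s\<in>{0..<int n}. of_bool [x = s] (mod int n)) = (1::'a::semiring_1)"
proof -
  have "{0..<int n} \<inter> {s. [x = s] (mod int n)} = {x mod int n}"
    using assms by (auto simp: cong_def)
  thus ?thesis by simp
qed

lemma sum_card_cong:
  assumes "finite S" "n > 0"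
  shows "(\<Sum>s\<in>{0..<int n}. card {x \<in> S. P x \<and> [L x = s] (mod int n)}) = card {x \<in> S. P x}"
proof -
  have "(\<Sum>s\<in>{0..<int n}. card {x \<in> S. P x \<and> [L x = s] (mod int n)}) =
    (\<Sum>s\<in>{0..<int n}. \<Sum>x\<in>S. of_bool (P x) * of_bool [L x = s] (mod int n))"
    using assms by (intro sum.cong refl) (simp only: card_Collect_eq_sum of_bool_conj)
  also have "\<dots> = (\<Sum>x\<in>S. of_bool (P x))"
    by (subst sum.swap) (simp only: sum_distrib_left[symmetric] sum_cong_residue[OF assms(2)] mult_1_right)
  finally show ?thesis using assms by (simp only: card_Collect_eq_sum)
qed

text \<open>Translation by multiples of one matrix unit permutes the fibres of the functional transitively.\<close>

lemma card_linear_cong: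
  fixes D :: "nat \<Rightarrow> nat \<Rightarrow> int"
  assumes n: "n > 0" and ij: "i0 < a" "j0 < b" and cop: "coprime (D i0 j0) (int n)"
  shows "card {Y \<in> residue_mats n a b. [(\<Sum>i<a. \<Sum>j<b. Y $$ (i, j) * D i j) = s] (mod int n)}
    = n ^ (a * b - 1)"
proof -
  define L where "L Y = (\<Sum>i<a. \<Sum>j<b. Y $$ (i, j) * D i j)" for Y
  define c where "c s = card {Y \<in> residue_mats n a b. [L Y = s] (mod int n)}" for s
  have c_shift: "c s = c (s + k)" for s k
  proof -
    obtain v where "[D i0 j0 * v = 1] (mod int n)"
      using cop cong_solve_coprime_int by blast
    \<comment> \<open>Adding \<open>u\<close> to the entry at \<open>(i0, j0)\<close> will change
      the functional by exactly \<open>k\<close>.\<close>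
    from cong_scalar_right[OF this, of k] obtain u where u: "[D i0 j0 * u = k] (mod int n)"
      by (metis mult.assoc mult_1)
    define Z where "Z = mat a b (\<lambda>ij. if ij = (i0, j0) then u else 0)"
    have Z: "Z \<in> carrier_mat a b" by (simp add: Z_def)
    let ?f = "\<lambda>Y. reduce_mat n (Y + Z)"
    have L: "[L (?f Y) = L Y + k] (mod int n)" if Y: "Y \<in> residue_mats n a b" for Y
    proof -
      note d = residue_matsD[OF Y]
      have "[L (?f Y) = (\<Sum>i<a. \<Sum>j<b. (Y $$ (i, j) + Z $$ (i, j)) * D i j)] (mod int n)"
        unfolding L_def using d Z by (intro cong_sum cong_mult) (auto simp: cong_def)
      also have "(\<Sum>i<a. \<Sum>j<b. (Y $$ (i, j) + Z $$ (i, j)) * D i j) =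
          L Y + (\<Sum>i<a. \<Sum>j<b. Z $$ (i, j) * D i j)"
        by (simp add: L_def algebra_simps sum.distrib)
      also have "(\<Sum>i<a. \<Sum>j<b. Z $$ (i, j) * D i j) =
          (\<Sum>i<a. \<Sum>j<b. if j = j0 then if i = i0 then u * D i j else 0 else 0)"
        by (intro sum.cong refl) (auto simp: Z_def)
      also have "\<dots> = D i0 j0 * u" using ij by (simp add: sum.delta)
      finally show ?thesis using u by (metis cong_add_lcancel cong_trans)
    qed
    have "bij_betw ?f {Y \<in> residue_mats n a b. [L Y = s] (mod int n)}
      {Y \<in> residue_mats n a b. [L Y = s + k] (mod int n)}"
    proof (rule bij_betw_Collect[OF bij_betw_shift_residue_mats[OF n Z]])
      fix Y assume "Y \<in> residue_mats n a b"
      from L[OF this] show "[L (?f Y) = s + k] (mod int n) \<longleftrightarrow> [L Y = s] (mod int n)"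
        by (metis cong_add_rcancel cong_sym cong_trans)
    qed
    thus ?thesis unfolding c_def by (rule bij_betw_same_card)
  qed
  \<comment> \<open>The \<open>n\<close> fibres partition all matrices and, by
    \<open>c_shift\<close>, have equal size.\<close>
  have "n ^ (a * b) = (\<Sum>s\<in>{0..<int n}. c s)"
    using sum_card_cong[of "residue_mats n a b" n "\<lambda>_. True" L] n
    by (simp add: c_def card_residue_mats)
  also have "\<dots> = (\<Sum>s'\<in>{0..<int n}. c s)"
    by (intro sum.cong refl) (metis c_shift add.commute diff_add_cancel)
  also have "\<dots> = n * c s" by simp
  finally have "n ^ (a * b) = n * c s" .
  moreover have "n ^ (a * b) = n * n ^ (a * b - 1)"
    using ij by (metis bot_nat_0.not_eq_extremum mult_is_0 not_less_zero power_eq_if)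
  ultimately show ?thesis using n by (simp add: c_def L_def)
qed

section \<open>Determinants mod \<open>n\<close> and invertibility\<close>

text \<open>By the Leibniz formula the determinant is an integer polynomial in the entries.\<close>

lemma det_cong:
  fixes A B :: "int mat"
  assumes "A \<in> carrier_mat r r" "B \<in> carrier_mat r r"
    and "\<And>i j. i < r \<Longrightarrow> j < r \<Longrightarrow> [A $$ (i, j) = B $$ (i, j)] (mod m)"
  shows "[det A = det B] (mod m)"
proof -
  have "p i < r" if "p permutes {0..<r}" "i \<in> {0..<r}" for p i
    using permutes_in_image[OF that(1), of i] that(2) by simp
  thus ?thesis
    unfolding det_def'[OF assms(1)] det_def'[OF assms(2)]
    by (intro cong_sum cong_mult cong_prod cong_refl) (auto intro!: assms(3))
qed

lemma det_reduce_mat_cong: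
  assumes "A \<in> carrier_mat r r" "d dvd n"
  shows "[det (reduce_mat n A) = det A] (mod int d)"
  by (rule det_cong[of _ r])
    (use assms in \<open>auto simp: cong_def mod_mod_cancel\<close>)

lemma mat_trace_reduce_mat_cong:
  assumes "A \<in> carrier_mat r r"
  shows "[mat_trace (reduce_mat n A) = mat_trace A] (mod int n)"
  unfolding mat_trace_def using assms
  by (simp, intro cong_sum) (auto simp: cong_def)

lemma coprime_cong_iff: "[a = b] (mod n) \<Longrightarrow> coprime a n \<longleftrightarrow> coprime b (n :: int)"
  by (metis cong_imp_coprime cong_sym)

text \<open>An inverse makes the determinant a unit by multiplicativity. Conversely, the adjugate
  times an inverse \<open>u\<close> of the determinant mod \<open>n\<close> is a two-sided
  inverse.\<close>

lemma GL_residues_eq: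
  assumes n: "n > 0"
  shows "GL_residues n r = {X \<in> residue_mats n r r. coprime (det X) (int n)}"
proof -
  have car: "carrier (residue_mat_ring n r) = residue_mats n r r"
    by (simp add: residue_mat_ring_def residue_mats_def)
  have mult: "A \<otimes>\<^bsub>residue_mat_ring n r\<^esub> B = reduce_mat n (A * B)" for A B
    by (simp add: residue_mat_ring_def)
  have one: "\<one>\<^bsub>residue_mat_ring n r\<^esub> = reduce_mat n (1\<^sub>m r)"
    by (simp add: residue_mat_ring_def)
  have "coprime (det X) (int n) \<and> X \<in> residue_mats n r r" if "X \<in> GL_residues n r" for X
  proof -
    from that obtain Y where X: "X \<in> residue_mats n r r" and Y: "Y \<in> residue_mats n r r"
      and XY: "reduce_mat n (X * Y) = reduce_mat n (1\<^sub>m r)"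
      by (auto simp: GL_residues_def Units_def car mult one)
    note X' = residue_matsD(1)[OF X] and Y' = residue_matsD(1)[OF Y]
    have "[det (X * Y) = 1] (mod int n)"
      using det_reduce_mat_cong[OF mult_carrier_mat[OF X' Y'], of n n]
        det_reduce_mat_cong[of "1\<^sub>m r :: int mat" r n n] XY
      by (metis cong_sym cong_trans det_one dvd_refl one_carrier_mat)
    hence "[det X * det Y = 1] (mod int n)" using det_mult[OF X' Y'] by simp
    hence "coprime (det X) (int n)" using coprime_iff_invertible_int by blast
    with X show ?thesis by simp
  qed
  moreover have "X \<in> GL_residues n r" if X: "X \<in> residue_mats n r r" and cop: "coprime (det X) (int n)" for X
  proof -
    note X' = residue_matsD(1)[OF X]
    note adj = adj_mat[OF X']
    obtain u where u: "[det X * u = 1] (mod int n)"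
      using cop cong_solve_coprime_int by blast
    define Z where "Z = u \<cdot>\<^sub>m adj_mat X"
    have Z: "Z \<in> carrier_mat r r" using adj(1) by (simp add: Z_def)
    have unit: "reduce_mat n ((u * det X) \<cdot>\<^sub>m 1\<^sub>m r) = reduce_mat n (1\<^sub>m r)"
      using u by (auto simp: cong_def mult.commute intro!: eq_matI)
    have "X * Z = (u * det X) \<cdot>\<^sub>m 1\<^sub>m r" "Z * X = (u * det X) \<cdot>\<^sub>m 1\<^sub>m r"
      using X' adj by (auto simp: Z_def mult_smult_distrib[of _ r r _ r] mult_smult_assoc_mat[of _ r r _ r])
    moreover have "reduce_mat n (X * reduce_mat n Z) = reduce_mat n (X * Z)"
      by (rule reduce_mat_mult_right[OF X' Z])
    moreover have "reduce_mat n (reduce_mat n Z * X) = reduce_mat n (Z * X)"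
      by (rule reduce_mat_mult_left[OF Z X'])
    ultimately show ?thesis
      using X reduce_mat_in_residue_mats[OF n Z] unit
      unfolding GL_residues_def Units_def car mult one by auto
  qed
  ultimately show ?thesis by blast
qed

section \<open>Reduction to prime modulus\<close>

text \<open>The trace \<open>t\<close> is any integer, not a reduced residue, so that the same
  \<open>t\<close> serves for all moduli.\<close>

definition trace_count :: "nat \<Rightarrow> nat \<Rightarrow> int \<Rightarrow> nat" where
  "trace_count n r t = card {X \<in> residue_mats n r r.
     coprime (det X) (int n) \<and> [mat_trace X = t] (mod int n)}"

text \<open>Injectivity is the uniqueness part of the Chinese remainder theorem, entry by entry;
  surjectivity follows because both sides have the same finite cardinality.\<close>

lemma bij_betw_crt_residue_mats:
  assumes cop: "coprime m n" and pos: "m > 0" "n > 0"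
  shows "bij_betw (\<lambda>X. (reduce_mat m X, reduce_mat n X)) (residue_mats (m * n) a b)
    (residue_mats m a b \<times> residue_mats n a b)"
proof -
  let ?f = "\<lambda>X. (reduce_mat m X, reduce_mat n X)"
  let ?A = "residue_mats (m * n) a b" and ?B = "residue_mats m a b \<times> residue_mats n a b"
  have inj: "inj_on ?f ?A"
  proof (intro inj_onI eq_matI)
    fix X Y i j
    assume X: "X \<in> ?A" and Y: "Y \<in> ?A" and eq: "?f X = ?f Y" and "i < dim_row Y" "j < dim_col Y"
    with residue_matsD[OF Y] have ij: "i < a" "j < b" by auto
    have "X $$ (i, j) mod int m = Y $$ (i, j) mod int m" "X $$ (i, j) mod int n = Y $$ (i, j) mod int n"
      using eq ij residue_matsD(2,3)[OF X] residue_matsD(2,3)[OF Y] reduce_mat_index by (metis Pair_inject)+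
    hence "[X $$ (i, j) = Y $$ (i, j)] (mod int m * int n)"
      using cop by (intro coprime_cong_mult) (auto simp: cong_def)
    thus "X $$ (i, j) = Y $$ (i, j)"
      using residue_matsD(4)[OF X ij] residue_matsD(4)[OF Y ij] by (simp add: cong_def)
  qed (auto dest: residue_matsD)
  moreover have "?f ` ?A = ?B"
  proof (rule card_subset_eq)
    show "?f ` ?A \<subseteq> ?B"
      using pos by (auto intro!: reduce_mat_in_residue_mats dest: residue_matsD)
    show "card (?f ` ?A) = card ?B"
      by (simp add: card_image[OF inj] card_cartesian_product card_residue_mats power_mult_distrib)
  qed simp
  ultimately show ?thesis by (simp add: bij_betw_def)
qed

text \<open>Coprimality to \<open>m * n\<close> and congruence mod \<open>m * n\<close> both split
  into the conditions mod \<open>m\<close> and mod \<open>n\<close>, and each depends only on the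
  reduced matrix.\<close>

lemma trace_count_mult:
  assumes cop: "coprime m n" and pos: "m > 0" "n > 0"
  shows "trace_count (m * n) r t = trace_count m r t * trace_count n r t"
proof -
  let ?P = "\<lambda>n X. coprime (det X) (int n) \<and> [mat_trace X = t] (mod int n)"
  have iff: "?P n (reduce_mat n X) \<longleftrightarrow> coprime (det X) (int n) \<and> [mat_trace X = t] (mod int n)"
    if "X \<in> carrier_mat r r" for X n
    using coprime_cong_iff[OF det_reduce_mat_cong[OF that dvd_refl]]
      mat_trace_reduce_mat_cong[OF that, of n] by (meson cong_sym cong_trans)
  have bij: "bij_betw (\<lambda>X. (reduce_mat m X, reduce_mat n X))
    {X \<in> residue_mats (m * n) r r. ?P (m * n) X}
    {Z \<in> residue_mats m r r \<times> residue_mats n r r. ?P m (fst Z) \<and> ?P n (snd Z)}"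
  proof (rule bij_betw_Collect[OF bij_betw_crt_residue_mats[OF assms]])
    fix X assume "X \<in> residue_mats (m * n) r r"
    hence X: "X \<in> carrier_mat r r" by (rule residue_matsD)
    have "[mat_trace X = t] (mod int (m * n)) \<longleftrightarrow>
        [mat_trace X = t] (mod int m) \<and> [mat_trace X = t] (mod int n)"
      using cop coprime_cong_mult[of "mat_trace X" t "int m" "int n"]
      by (metis cong_modulus_mult mult.commute of_nat_mult coprime_int_iff)
    thus "?P m (fst (reduce_mat m X, reduce_mat n X)) \<and> ?P n (snd (reduce_mat m X, reduce_mat n X))
      \<longleftrightarrow> ?P (m * n) X"
      by (auto simp: iff[OF X])
  qed
  have "{Z \<in> residue_mats m r r \<times> residue_mats n r r. ?P m (fst Z) \<and> ?P n (snd Z)} =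
    {X \<in> residue_mats m r r. ?P m X} \<times> {X \<in> residue_mats n r r. ?P n X}" by auto
  thus ?thesis
    using bij_betw_same_card[OF bij] by (simp add: trace_count_def card_cartesian_product)
qed

text \<open>The trace is the linear functional whose coefficients form the identity matrix; its
  coefficient at \<open>(0, 0)\<close> is a unit.\<close>

lemma card_mat_trace_cong:
  assumes "n > 0" "r > 0"
  shows "card {Y \<in> residue_mats n r r. [mat_trace Y = s] (mod int n)} = n ^ (r * r - 1)"
proof -
  have "(\<Sum>i<r. \<Sum>j<r. Y $$ (i, j) * of_bool (i = j)) = mat_trace Y"
    if "Y \<in> residue_mats n r r" for Y
    using residue_matsD[OF that] by (simp add: mat_trace_def of_bool_def if_distrib[of "(*) c" for c] cong: if_cong)
  thus ?thesis
    using card_linear_cong[of n 0 r 0 r "\<lambda>i j. of_bool (i = j)" s] assms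
    by (simp cong: conj_cong)
qed

text \<open>Entrywise, \<open>X\<close> is the remainder and \<open>Y\<close> the quotient on
  division by \<open>n\<close>. Surjectivity again follows by counting.\<close>

lemma bij_betw_digit_residue_mats:
  assumes pos: "n > 0" "p > 0"
  shows "bij_betw (\<lambda>(X, Y). X + int n \<cdot>\<^sub>m Y) (residue_mats n a b \<times> residue_mats p a b)
    (residue_mats (n * p) a b)"
proof -
  let ?f = "\<lambda>(X, Y). X + int n \<cdot>\<^sub>m Y"
  let ?A = "residue_mats n a b \<times> residue_mats p a b" and ?B = "residue_mats (n * p) a b"
  have ent: "(X + int n \<cdot>\<^sub>m Y) $$ (i, j) = X $$ (i, j) + int n * Y $$ (i, j)"
    if "X \<in> residue_mats n a b" "Y \<in> residue_mats p a b" "i < a" "j < b" for X Y i j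
    using that residue_matsD(2,3)[OF that(1)] residue_matsD(2,3)[OF that(2)] by simp
  have digits: "X $$ (i, j) = (X + int n \<cdot>\<^sub>m Y) $$ (i, j) mod int n"
    "Y $$ (i, j) = (X + int n \<cdot>\<^sub>m Y) $$ (i, j) div int n"
    if "X \<in> residue_mats n a b" "Y \<in> residue_mats p a b" "i < a" "j < b" for X Y i j
    using ent[OF that] residue_matsD(4)[OF that(1,3,4)] pos by auto
  have inj: "inj_on ?f ?A"
  proof (intro inj_onI, clarify)
    fix X Y X' Y'
    assume m: "X \<in> residue_mats n a b" "Y \<in> residue_mats p a b" "X' \<in> residue_mats n a b" "Y' \<in> residue_mats p a b"
      and eq: "X + int n \<cdot>\<^sub>m Y = X' + int n \<cdot>\<^sub>m Y'"
    have "X = X'"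
    proof (rule eq_matI)
      fix i j assume "i < dim_row X'" "j < dim_col X'"
      hence ij: "i < a" "j < b" using residue_matsD(2,3)[OF m(3)] by auto
      show "X $$ (i, j) = X' $$ (i, j)"
        using digits(1)[OF m(1,2) ij] digits(1)[OF m(3,4) ij] eq by metis
    qed (use residue_matsD(2,3)[OF m(1)] residue_matsD(2,3)[OF m(3)] in simp_all)
    moreover have "Y = Y'"
    proof (rule eq_matI)
      fix i j assume "i < dim_row Y'" "j < dim_col Y'"
      hence ij: "i < a" "j < b" using residue_matsD(2,3)[OF m(4)] by auto
      show "Y $$ (i, j) = Y' $$ (i, j)"
        using digits(2)[OF m(1,2) ij] digits(2)[OF m(3,4) ij] eq by metis
    qed (use residue_matsD(2,3)[OF m(2)] residue_matsD(2,3)[OF m(4)] in simp_all)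
    ultimately show "X = X' \<and> Y = Y'" ..
  qed
  moreover have "?f ` ?A = ?B"
  proof (rule card_subset_eq)
    show "?f ` ?A \<subseteq> ?B"
    proof clarify
      fix X Y assume m: "X \<in> residue_mats n a b" "Y \<in> residue_mats p a b"
      have "0 \<le> X $$ (i, j) + int n * Y $$ (i, j) \<and> X $$ (i, j) + int n * Y $$ (i, j) < int n * int p"
        if ij: "i < a" "j < b" for i j
      proof -
        have "int n * (Y $$ (i, j) + 1) \<le> int n * int p"
          using residue_matsD(4)[OF m(2) ij] by (intro mult_left_mono) auto
        thus ?thesis
          using residue_matsD(4)[OF m(1) ij] residue_matsD(4)[OF m(2) ij] by (auto simp: distrib_left)
      qed
      thus "X + int n \<cdot>\<^sub>m Y \<in> ?B"
        using residue_matsD(1)[OF m(1)] residue_matsD(1)[OF m(2)] by (auto simp: residue_mats_def)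
    qed
    show "card (?f ` ?A) = card ?B"
      by (simp add: card_image[OF inj] card_cartesian_product card_residue_mats power_mult_distrib)
  qed simp
  ultimately show ?thesis by (simp add: bij_betw_def)
qed

text \<open>Since \<open>p dvd n\<close>, the determinant condition mod \<open>n * p\<close> only
  concerns the low digit \<open>X\<close>. The high digit \<open>Y\<close> enters through the trace
  alone, and only as \<open>int n * mat_trace Y\<close>.\<close>

lemma trace_count_mult_dvd:
  assumes pos: "n > 0" "p > 0" and dvd: "p dvd n" and r: "r > 0"
  shows "trace_count (n * p) r t = p ^ (r * r - 1) * trace_count n r t"
proof -
  let ?S = "{X \<in> residue_mats n r r. coprime (det X) (int n)}"
  let ?T = "\<lambda>X. {Y \<in> residue_mats p r r. [mat_trace X + int n * mat_trace Y = t] (mod int (n * p))}"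
  have bij: "bij_betw (\<lambda>(X, Y). X + int n \<cdot>\<^sub>m Y)
    {Z \<in> residue_mats n r r \<times> residue_mats p r r. coprime (det (fst Z)) (int n) \<and>
       [mat_trace (fst Z) + int n * mat_trace (snd Z) = t] (mod int (n * p))}
    {X \<in> residue_mats (n * p) r r. coprime (det X) (int (n * p)) \<and> [mat_trace X = t] (mod int (n * p))}"
  proof (rule bij_betw_Collect[OF bij_betw_digit_residue_mats[OF pos]], clarify)
    fix X Y assume m: "X \<in> residue_mats n r r" "Y \<in> residue_mats p r r"
    note d = residue_matsD[OF m(1)] residue_matsD[OF m(2)]
    let ?Z = "X + int n \<cdot>\<^sub>m Y"
    have "[det ?Z = det X] (mod int n)"
      by (rule det_cong[of _ r]) (use d(1-3,5-7) in \<open>auto simp: cong_def\<close>)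
    hence "coprime (det ?Z) (int n) \<longleftrightarrow> coprime (det X) (int n)" by (rule coprime_cong_iff)
    moreover have "coprime (det ?Z) (int p)" if "coprime (det ?Z) (int n)"
      using that dvd by (meson coprime_divisors dvd_refl of_nat_dvd_iff)
    moreover have "mat_trace ?Z = mat_trace X + int n * mat_trace Y"
      using d(1-3,5-7) by (simp add: mat_trace_def sum.distrib sum_distrib_left)
    ultimately show "coprime (det ?Z) (int (n * p)) \<and> [mat_trace ?Z = t] (mod int (n * p)) \<longleftrightarrow>
      coprime (det (fst (X, Y))) (int n) \<and>
      [mat_trace (fst (X, Y)) + int n * mat_trace (snd (X, Y)) = t] (mod int (n * p))"
      by (simp add: coprime_mult_right_iff) blast
  qed
  have "{Z \<in> residue_mats n r r \<times> residue_mats p r r. coprime (det (fst Z)) (int n) \<and>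
       [mat_trace (fst Z) + int n * mat_trace (snd Z) = t] (mod int (n * p))} = Sigma ?S ?T" by auto
  hence "trace_count (n * p) r t = card (Sigma ?S ?T)"
    using bij_betw_same_card[OF bij] unfolding trace_count_def by simp
  also have "\<dots> = (\<Sum>X\<in>?S. card (?T X))" by (rule card_SigmaI) auto
  also have "\<dots> = (\<Sum>X\<in>?S. p ^ (r * r - 1) * of_bool [mat_trace X = t] (mod int n))"
  proof (rule sum.cong[OF refl])
    fix X
    show "card (?T X) = p ^ (r * r - 1) * of_bool [mat_trace X = t] (mod int n)"
    proof (cases "[mat_trace X = t] (mod int n)")
      case True
      \<comment> \<open>Cancelling \<open>n\<close> turns the trace condition into: the trace of
        \<open>Y\<close> is \<open>k\<close> mod \<open>p\<close>.\<close>
      then obtain k where k: "t = mat_trace X + int n * k"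
        using cong_iff_lin by (metis mult.commute)
      have "[mat_trace X + int n * y = t] (mod int (n * p)) \<longleftrightarrow> [y = k] (mod int p)" for y
        using pos by (simp add: k cong_add_lcancel) (simp add: cong_def)
      thus ?thesis using True card_mat_trace_cong[OF pos(2) r, of k] by simp
    next
      case False
      have "\<not> [mat_trace X + int n * y = t] (mod int (n * p))" for y
      proof
        assume "[mat_trace X + int n * y = t] (mod int (n * p))"
        hence "[mat_trace X + int n * y = t] (mod int n)"
          by (simp add: cong_modulus_mult)
        thus False using False by (simp add: cong_def)
      qed
      thus ?thesis using False by simp
    qed
  qed
  also have "\<dots> = p ^ (r * r - 1) * card {X \<in> ?S. [mat_trace X = t] (mod int n)}"
    by (subst card_Collect_eq_sum) (auto simp: sum_distrib_left)
  also have "{X \<in> ?S. [mat_trace X = t] (mod int n)} =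
    {X \<in> residue_mats n r r. coprime (det X) (int n) \<and> [mat_trace X = t] (mod int n)}" by auto
  finally show ?thesis by (simp add: trace_count_def)
qed

section \<open>Bordered matrices and their determinants\<close>

definition bordered_mat :: "int mat \<Rightarrow> int mat \<Rightarrow> int mat \<Rightarrow> int \<Rightarrow> int mat" where
  "bordered_mat A b w c = four_block_mat A b w (mat 1 1 (\<lambda>_. c))"

lemma bordered_mat_carrier [simp]:
  assumes "A \<in> carrier_mat r r"
  shows "bordered_mat A b w c \<in> carrier_mat (Suc r) (Suc r)"
    and "dim_row (bordered_mat A b w c) = Suc r" "dim_col (bordered_mat A b w c) = Suc r"
  using assms by (auto simp: bordered_mat_def)

lemma bordered_mat_index:
  assumes "A \<in> carrier_mat r r" "b \<in> carrier_mat r 1" "w \<in> carrier_mat 1 r"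
  shows "i < r \<Longrightarrow> j < r \<Longrightarrow> bordered_mat A b w c $$ (i, j) = A $$ (i, j)"
    and "i < r \<Longrightarrow> bordered_mat A b w c $$ (i, r) = b $$ (i, 0)"
    and "j < r \<Longrightarrow> bordered_mat A b w c $$ (r, j) = w $$ (0, j)"
    and "bordered_mat A b w c $$ (r, r) = c"
  using assms by (auto simp: bordered_mat_def)

lemma mat_trace_bordered_mat:
  assumes "A \<in> carrier_mat r r" "b \<in> carrier_mat r 1" "w \<in> carrier_mat 1 r"
  shows "mat_trace (bordered_mat A b w c) = mat_trace A + c"
  using assms by (simp add: mat_trace_def bordered_mat_index[OF assms] bordered_mat_carrier[OF assms(1)])

text \<open>The tuple lists \<open>b\<close> last so that the column is the innermost summation
  variable in \<open>sum_bordered_mat\<close>. Surjectivity comes from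
  \<open>(r + 1)^2 = r^2 + r + 1 + r\<close>.\<close>

lemma bij_betw_bordered_mat:
  assumes "n > 0"
  shows "bij_betw (\<lambda>(A, w, c, b). bordered_mat A b w c)
    (residue_mats n r r \<times> residue_mats n 1 r \<times> {0..<int n} \<times> residue_mats n r 1)
    (residue_mats n (Suc r) (Suc r))"
proof -
  let ?f = "\<lambda>(A, w, c, b). bordered_mat A b w c"
  let ?D = "residue_mats n r r \<times> residue_mats n 1 r \<times> {0..<int n} \<times> residue_mats n r 1"
  have inj: "inj_on ?f ?D"
  proof (rule inj_onI)
    fix Z Z' assume Z: "Z \<in> ?D" "Z' \<in> ?D" and f: "?f Z = ?f Z'"
    obtain A w c b where Z1: "Z = (A, w, c, b)" by (cases Z)
    obtain A' w' c' b' where Z2: "Z' = (A', w', c', b')" by (cases Z')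
    have m: "A \<in> residue_mats n r r" "w \<in> residue_mats n 1 r" "b \<in> residue_mats n r 1"
        "A' \<in> residue_mats n r r" "w' \<in> residue_mats n 1 r" "b' \<in> residue_mats n r 1"
      and eq: "bordered_mat A b w c = bordered_mat A' b' w' c'"
      using Z f by (simp_all add: Z1 Z2)
    note c = m[THEN residue_matsD(1)]
    note ix = bordered_mat_index[OF c(1,3,2)] and ix' = bordered_mat_index[OF c(4,6,5)]
    have "A = A'"
    proof (rule eq_matI)
      fix i j assume "i < dim_row A'" "j < dim_col A'"
      thus "A $$ (i, j) = A' $$ (i, j)" using c(4) ix(1)[of i j c] ix'(1)[of i j c'] eq by simp
    qed (use c(1,4) in auto)
    moreover have "w = w'"
    proof (rule eq_matI)
      fix i j assume "i < dim_row w'" "j < dim_col w'"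
      thus "w $$ (i, j) = w' $$ (i, j)" using c(5) ix(3)[of j c] ix'(3)[of j c'] eq by simp
    qed (use c(2,5) in auto)
    moreover have "b = b'"
    proof (rule eq_matI)
      fix i j assume "i < dim_row b'" "j < dim_col b'"
      thus "b $$ (i, j) = b' $$ (i, j)" using c(6) ix(2)[of i c] ix'(2)[of i c'] eq by simp
    qed (use c(3,6) in auto)
    moreover have "c = c'" using ix(4) ix'(4) eq by metis
    ultimately show "Z = Z'" by (simp add: Z1 Z2)
  qed
  moreover have "?f ` ?D = residue_mats n (Suc r) (Suc r)"
  proof (rule card_subset_eq)
    show "?f ` ?D \<subseteq> residue_mats n (Suc r) (Suc r)"
    proof clarify
      fix A w c b
      assume m: "A \<in> residue_mats n r r" "w \<in> residue_mats n 1 r" "b \<in> residue_mats n r 1"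
        and c: "c \<in> {0..<int n}"
      note car = m[THEN residue_matsD(1)]
      have "bordered_mat A b w c $$ (i, j) \<in> {0..<int n}" if "i < Suc r" "j < Suc r" for i j
        using that bordered_mat_index[OF car(1,3,2)] c
          residue_matsD(4)[OF m(1), of i j] residue_matsD(4)[OF m(2), of 0 j] residue_matsD(4)[OF m(3), of i 0]
        by (cases "i = r"; cases "j = r") (simp_all add: less_Suc_eq)
      thus "bordered_mat A b w c \<in> residue_mats n (Suc r) (Suc r)"
        using car(1) by (simp add: residue_mats_def)
    qed
    show "card (?f ` ?D) = card (residue_mats n (Suc r) (Suc r))"
      unfolding card_image[OF inj] by (simp add: card_cartesian_product card_residue_mats power_add mult_ac)
  qed simp
  ultimately show ?thesis by (simp add: bij_betw_def)
qed

lemma sum_bordered_mat: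
  assumes "n > 0"
  shows "(\<Sum>X\<in>residue_mats n (Suc r) (Suc r). h X) =
    (\<Sum>A\<in>residue_mats n r r. \<Sum>w\<in>residue_mats n 1 r. \<Sum>c\<in>{0..<int n}. \<Sum>b\<in>residue_mats n r 1.
       h (bordered_mat A b w c))"
  unfolding sum.reindex_bij_betw[OF bij_betw_bordered_mat[OF assms], symmetric] sum.cartesian_product
  by (simp add: case_prod_unfold)

text \<open>This is the cofactor of the \<open>i\<close>-th entry of the border column, written as a
  determinant with a unit vector as column and corner 0. No explicit sign or deleted row is
  needed.\<close>

definition border_minor :: "int mat \<Rightarrow> int mat \<Rightarrow> nat \<Rightarrow> int" where
  "border_minor A w i = det (bordered_mat A (mat (dim_row A) 1 (\<lambda>(k, _). of_bool (k = i))) w 0)"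

lemma det_bordered_mat_zero:
  assumes "A \<in> carrier_mat r r" "b \<in> carrier_mat r 1" "w \<in> carrier_mat 1 r"
  shows "b = 0\<^sub>m r 1 \<or> w = 0\<^sub>m 1 r \<Longrightarrow> det (bordered_mat A b w c) = det A * c"
proof (elim disjE)
  have c: "det (mat 1 1 (\<lambda>_. c)) = c" by (simp add: det_single)
  show "det (bordered_mat A b w c) = det A * c" if "b = 0\<^sub>m r 1"
    unfolding bordered_mat_def by (subst det_four_block_mat_upper_right_zero[of _ r _ 1]) (use assms that c in auto)
  show "det (bordered_mat A b w c) = det A * c" if "w = 0\<^sub>m 1 r"
    unfolding bordered_mat_def by (subst det_four_block_mat_lower_left_zero[of _ r _ 1]) (use assms that c in auto)
qed

text \<open>Laplace expansion along the last column. Its cofactors do not see that column, so they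
  can be taken at \<open>b = 0\<close>, \<open>c = 0\<close> and then identified by evaluating the
  expansion at special columns.\<close>

lemma det_bordered_mat:
  assumes A: "A \<in> carrier_mat r r" and b: "b \<in> carrier_mat r 1" and w: "w \<in> carrier_mat 1 r"
  shows "det (bordered_mat A b w c) = c * det A + (\<Sum>i<r. b $$ (i, 0) * border_minor A w i)"
proof -
  define C where "C i = cofactor (bordered_mat A (0\<^sub>m r 1) w 0) i r" for i
  have cofactor: "cofactor (bordered_mat A b w c) i r = C i" if "b \<in> carrier_mat r 1" "i \<le> r" for b c i
  proof -
    have z: "0\<^sub>m r 1 \<in> carrier_mat r 1" by simp
    have ent: "bordered_mat A b w c $$ (k, j) = bordered_mat A (0\<^sub>m r 1) w 0 $$ (k, j)"
      if "k < Suc r" "j < r" for k j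
      using that bordered_mat_index(1)[OF A \<open>b \<in> carrier_mat r 1\<close> w, of k j c]
        bordered_mat_index(3)[OF A \<open>b \<in> carrier_mat r 1\<close> w, of j c]
        bordered_mat_index(1)[OF A z w, of k j 0] bordered_mat_index(3)[OF A z w, of j 0]
      by (cases "k = r") simp_all
    have "mat_delete (bordered_mat A b w c) i r = mat_delete (bordered_mat A (0\<^sub>m r 1) w 0) i r"
      unfolding mat_delete_def bordered_mat_carrier(2,3)[OF A] using that(2) by (intro eq_matI) (auto simp: ent)
    thus ?thesis by (simp add: C_def cofactor_def)
  qed
  have det: "det (bordered_mat A b w c) = (\<Sum>i<r. b $$ (i, 0) * C i) + c * C r"
    if "b \<in> carrier_mat r 1" for b c
    using laplace_expansion_column[OF bordered_mat_carrier(1)[OF A], of r b w c]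
    by (simp add: cofactor[OF that] bordered_mat_index[OF A that w])
  \<comment> \<open>Evaluation at \<open>b = 0\<close>, \<open>c = 1\<close>, where the matrix is
    block triangular.\<close>
  have "C r = det A"
    using det[of "0\<^sub>m r 1" 1] det_bordered_mat_zero[OF A _ w, of "0\<^sub>m r 1" 1] by simp
  moreover have "border_minor A w i = C i" if "i < r" for i
    using A that by (simp add: border_minor_def det)
  ultimately show ?thesis by (simp add: det[OF b])
qed

text \<open>Bordering by column \<open>j\<close> of the matrix itself makes the determinant vanish.\<close>

lemma dvd_border_minor_imp:
  assumes A: "A \<in> carrier_mat r r" and w: "w \<in> carrier_mat 1 r" and j: "j < r"
    and dvd: "\<And>i. i < r \<Longrightarrow> m dvd border_minor A w i"
  shows "m dvd w $$ (0, j) * det A"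
proof -
  define b where "b = mat r 1 (\<lambda>(i, _). A $$ (i, j))"
  have b: "b \<in> carrier_mat r 1" by (simp add: b_def)
  have b_index: "b $$ (i, 0) = A $$ (i, j)" if "i < r" for i using that by (simp add: b_def)
  \<comment> \<open>With this corner the last column repeats column \<open>j\<close> in the bottom
    row as well.\<close>
  let ?X = "bordered_mat A b w (w $$ (0, j))"
  have "col ?X j = col ?X r"
  proof (rule eq_vecI)
    fix i assume "i < dim_vec (col ?X r)"
    hence i: "i < Suc r" using A by simp
    show "col ?X j $ i = col ?X r $ i"
      using i j A by (cases "i = r") (simp_all add: bordered_mat_index[OF A b w] b_index)
  qed (use A in simp)
  hence "det ?X = 0"
    using det_identical_columns[OF bordered_mat_carrier(1)[OF A], of j r] j by simp
  hence "w $$ (0, j) * det A = - (\<Sum>i<r. b $$ (i, 0) * border_minor A w i)"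
    using det_bordered_mat[OF A b w, of "w $$ (0, j)"] by linarith
  thus ?thesis using dvd by (auto intro!: dvd_sum)
qed

text \<open>Schur complement: right multiplication by the unipotent \<open>?E\<close> subtracts
  \<open>b * w\<close> from \<open>A\<close> and clears the row \<open>w\<close>.\<close>

lemma det_bordered_mat_1:
  assumes A: "A \<in> carrier_mat r r" and b: "b \<in> carrier_mat r 1" and w: "w \<in> carrier_mat 1 r"
  shows "det (bordered_mat A b w 1) = det (A + - (b * w))"
proof -
  have one: "mat 1 1 (\<lambda>_. 1) = (1\<^sub>m 1 :: int mat)" by (rule eq_matI) auto
  let ?E = "four_block_mat (1\<^sub>m r) (0\<^sub>m r 1) (- w) (1\<^sub>m 1)"
  have E: "?E \<in> carrier_mat (Suc r) (Suc r)" using w by auto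
  have bw: "b * - w = - (b * w)" using b w by auto
  have ww: "w + - w = 0\<^sub>m 1 r" using w by auto
  have "bordered_mat A b w 1 * ?E = four_block_mat (A + - (b * w)) b (0\<^sub>m 1 r) (1\<^sub>m 1)"
    unfolding bordered_mat_def one
    by (subst mult_four_block_mat[OF A b w one_carrier_mat one_carrier_mat zero_carrier_mat _ one_carrier_mat])
      (use A b w bw ww in auto)
  hence "det (bordered_mat A b w 1) * det ?E = det (four_block_mat (A + - (b * w)) b (0\<^sub>m 1 r) (1\<^sub>m 1))"
    using det_mult[OF bordered_mat_carrier(1)[OF A] E, of b w 1] by simp
  moreover have "det ?E = 1"
    by (subst det_four_block_mat_upper_right_zero[of _ r _ 1]) (use w in auto)
  moreover have "det (four_block_mat (A + - (b * w)) b (0\<^sub>m 1 r) (1\<^sub>m 1)) = det (A + - (b * w))"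
    by (subst det_four_block_mat_lower_left_zero[of _ r _ 1]) (use A b w in auto)
  ultimately show ?thesis by simp
qed

text \<open>If some border minor is nonzero mod \<open>p\<close>, the determinant is a nonconstant
  affine function of \<open>b\<close>, with \<open>p^(r-1)\<close> zeros for every \<open>c\<close>.
  If all vanish, a nonzero entry of \<open>w\<close> forces \<open>p\<close> to divide
  \<open>det A\<close>, so the determinant is 0 mod \<open>p\<close> for all \<open>b\<close> and
  \<open>c\<close>.\<close>

lemma card_det_bordered_mat_indep:
  assumes p: "prime p" and A: "A \<in> residue_mats p r r" and w: "w \<in> residue_mats p 1 r"
    and w0: "w \<noteq> 0\<^sub>m 1 r"
  shows "card {b \<in> residue_mats p r 1. \<not> int p dvd det (bordered_mat A b w c)} =
    card {b \<in> residue_mats p r 1. \<not> int p dvd det (bordered_mat A b w 0)}"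
proof -
  note A' = residue_matsD(1)[OF A] and w' = residue_matsD(1)[OF w]
  have prime: "prime (int p)" and pos: "p > 0" using p by (simp_all add: prime_gt_0_nat)
  show ?thesis
  proof (cases "\<exists>i<r. \<not> int p dvd border_minor A w i")
    case True
    then obtain i where i: "i < r" "\<not> int p dvd border_minor A w i" by blast
    hence cop: "coprime (border_minor A w i) (int p)"
      using prime by (simp add: prime_imp_coprime coprime_commute)
    have "card {b \<in> residue_mats p r 1. \<not> int p dvd det (bordered_mat A b w c)} = p ^ r - p ^ (r - 1)" for c
    proof -
      have "{b \<in> residue_mats p r 1. \<not> int p dvd det (bordered_mat A b w c)} = residue_mats p r 1 -
        {b \<in> residue_mats p r 1. [(\<Sum>i<r. \<Sum>j<1. b $$ (i, j) * border_minor A w i) = - (c * det A)] (mod int p)}"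
        using det_bordered_mat[OF A' residue_matsD(1) w']
        by (auto simp: cong_iff_dvd_diff add.commute)
      also have "card \<dots> = p ^ r - p ^ (r - 1)"
        using card_linear_cong[of p i r 0 1 "\<lambda>i j. border_minor A w i" "- (c * det A)"] pos i cop
        by (subst card_Diff_subset) (auto simp: card_residue_mats)
      finally show ?thesis .
    qed
    thus ?thesis by metis
  next
    case False
    have "\<exists>j<r. w $$ (0, j) \<noteq> 0"
    proof (rule ccontr)
      assume "\<not> ?thesis"
      hence "w = 0\<^sub>m 1 r" using w' by (intro eq_matI) auto
      thus False using w0 by blast
    qed
    then obtain j where j: "j < r" "w $$ (0, j) \<noteq> 0" by blast
    have "\<not> int p dvd w $$ (0, j)"
      using residue_matsD(4)[OF w, of 0 j] j zdvd_not_zless[of "w $$ (0, j)" "int p"] by auto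
    hence "int p dvd det A"
      using dvd_border_minor_imp[OF A' w' j(1), of "int p"] False prime_dvd_mult_iff[OF prime] by blast
    hence "int p dvd det (bordered_mat A b w c)" if "b \<in> residue_mats p r 1" for b c
      using False by (auto simp: det_bordered_mat[OF A' residue_matsD(1)[OF that] w'] intro!: dvd_sum dvd_add)
    thus ?thesis by (metis (no_types, lifting) Collect_cong)
  qed
qed

section \<open>Recursion in the size over a prime modulus\<close>

context
  fixes p :: nat
  assumes p: "prime p"
begin

text \<open>An indicator with integer values: counts become sums that can be reweighted, reordered
  and subtracted.\<close>

definition unit_det :: "int mat \<Rightarrow> int" where
  "unit_det X = of_bool (\<not> int p dvd det X)"

definition gl_count :: "nat \<Rightarrow> int" where
  "gl_count r = (\<Sum>X\<in>residue_mats p r r. unit_det X)"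

lemma int_trace_count_prime:
  "int (trace_count p r t) = (\<Sum>X\<in>residue_mats p r r. unit_det X * of_bool [mat_trace X = t] (mod int p))"
proof -
  have "coprime (det X) (int p) \<longleftrightarrow> \<not> int p dvd det X" for X
    using p by (metis coprime_commute not_prime_unit coprime_absorb_left prime_imp_coprime prime_nat_int_transfer)
  thus ?thesis
    unfolding trace_count_def unit_det_def
    by (simp add: card_Collect_eq_sum of_bool_conj del: sum_of_bool_eq sum_of_bool_mult_eq sum_mult_of_bool_eq)
qed

lemma gl_count_eq_sum: "gl_count r = (\<Sum>t\<in>{0..<int p}. int (trace_count p r t))"
proof -
  have "(\<Sum>t\<in>{0..<int p}. int (trace_count p r t)) =
    (\<Sum>X\<in>residue_mats p r r. unit_det X * (\<Sum>t\<in>{0..<int p}. of_bool [mat_trace X = t] (mod int p)))"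
    unfolding int_trace_count_prime by (subst sum.swap) (simp only: sum_distrib_left)
  also have "\<dots> = gl_count r"
    using prime_gt_0_nat[OF p] by (simp only: sum_cong_residue gl_count_def mult_1_right)
  finally show ?thesis ..
qed

lemma sum_unit_det_bordered_indep:
  assumes "A \<in> residue_mats p r r" "w \<in> residue_mats p 1 r" "w \<noteq> 0\<^sub>m 1 r"
  shows "(\<Sum>b\<in>residue_mats p r 1. unit_det (bordered_mat A b w c)) =
    (\<Sum>b\<in>residue_mats p r 1. unit_det (bordered_mat A b w 0))"
proof -
  have "(\<Sum>b\<in>residue_mats p r 1. unit_det (bordered_mat A b w c)) =
    int (card {b \<in> residue_mats p r 1. \<not> int p dvd det (bordered_mat A b w c)})" for c
    by (simp add: unit_det_def card_Collect_eq_sum del: sum_of_bool_eq)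
  thus ?thesis using card_det_bordered_mat_indep[OF p assms] by simp
qed

lemma sum_unit_det_bordered_zero:
  assumes "A \<in> residue_mats p r r"
  shows "(\<Sum>b\<in>residue_mats p r 1. unit_det (bordered_mat A b (0\<^sub>m 1 r) c)) =
    int p ^ r * (unit_det A * of_bool (\<not> int p dvd c))"
proof -
  have "unit_det (bordered_mat A b (0\<^sub>m 1 r) c) = unit_det A * of_bool (\<not> int p dvd c)"
    if "b \<in> residue_mats p r 1" for b
    using det_bordered_mat_zero[OF residue_matsD(1)[OF assms] residue_matsD(1)[OF that], of "0\<^sub>m 1 r" c] p
    by (simp add: unit_det_def prime_dvd_mult_iff)
  thus ?thesis by (simp add: card_residue_mats)
qed

text \<open>The constant \<open>K\<close> of the recursion. The corner 0 is an arbitrary choice, by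
  \<open>sum_unit_det_bordered_indep\<close>.\<close>

definition border_sum :: "nat \<Rightarrow> int" where
  "border_sum r = (\<Sum>A\<in>residue_mats p r r. \<Sum>w\<in>residue_mats p 1 r - {0\<^sub>m 1 r}.
     \<Sum>b\<in>residue_mats p r 1. unit_det (bordered_mat A b w 0))"

text \<open>Only the bordered matrices with \<open>w = 0\<close> see the weight \<open>g\<close>.\<close>

lemma weighted_sum_bordered:
  assumes g: "\<And>A. (\<Sum>c\<in>{0..<int p}. g A c) = 1"
  shows "(\<Sum>A\<in>residue_mats p r r. \<Sum>w\<in>residue_mats p 1 r. \<Sum>c\<in>{0..<int p}. \<Sum>b\<in>residue_mats p r 1.
      unit_det (bordered_mat A b w c) * g A c) =
    border_sum r + int p ^ r * (\<Sum>A\<in>residue_mats p r r. unit_det A *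
      (\<Sum>c\<in>{0..<int p}. of_bool (\<not> int p dvd c) * g A c))"
proof -
  let ?s = "\<lambda>A w c. \<Sum>b\<in>residue_mats p r 1. unit_det (bordered_mat A b w c)"
  have z: "0\<^sub>m 1 r \<in> residue_mats p 1 r"
    using prime_gt_0_nat[OF p] by (simp add: residue_mats_def)
  have "(\<Sum>w\<in>residue_mats p 1 r. \<Sum>c\<in>{0..<int p}. ?s A w c * g A c) =
      int p ^ r * (unit_det A * (\<Sum>c\<in>{0..<int p}. of_bool (\<not> int p dvd c) * g A c)) +
      (\<Sum>w\<in>residue_mats p 1 r - {0\<^sub>m 1 r}. ?s A w 0)" if A: "A \<in> residue_mats p r r" for A
  proof -
    have "(\<Sum>c\<in>{0..<int p}. ?s A w c * g A c) = ?s A w 0"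
      if "w \<in> residue_mats p 1 r - {0\<^sub>m 1 r}" for w
    proof -
      \<comment> \<open>For \<open>w\<close> nonzero the sum over \<open>b\<close> is independent of
        the corner, so weights of total 1 leave it unchanged.\<close>
      have "(\<Sum>c\<in>{0..<int p}. ?s A w c * g A c) = (\<Sum>c\<in>{0..<int p}. ?s A w 0 * g A c)"
        using sum_unit_det_bordered_indep[OF A, of w] that by (intro sum.cong refl) (metis DiffE singletonI)
      also have "\<dots> = ?s A w 0" by (simp only: sum_distrib_left[symmetric] g mult_1_right)
      finally show ?thesis .
    qed
    moreover have "(\<Sum>c\<in>{0..<int p}. ?s A (0\<^sub>m 1 r) c * g A c) =
        int p ^ r * (unit_det A * (\<Sum>c\<in>{0..<int p}. of_bool (\<not> int p dvd c) * g A c))"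
      by (simp only: sum_unit_det_bordered_zero[OF A] sum_distrib_left mult.assoc)
    ultimately show ?thesis by (subst sum.remove[OF finite_residue_mats z]) simp
  qed
  hence "(\<Sum>A\<in>residue_mats p r r. \<Sum>w\<in>residue_mats p 1 r. \<Sum>c\<in>{0..<int p}. ?s A w c * g A c) =
      (\<Sum>A\<in>residue_mats p r r.
        int p ^ r * (unit_det A * (\<Sum>c\<in>{0..<int p}. of_bool (\<not> int p dvd c) * g A c)) +
        (\<Sum>w\<in>residue_mats p 1 r - {0\<^sub>m 1 r}. ?s A w 0))"
    by (rule sum.cong[OF refl])
  also have "\<dots> = border_sum r + int p ^ r * (\<Sum>A\<in>residue_mats p r r. unit_det A *
      (\<Sum>c\<in>{0..<int p}. of_bool (\<not> int p dvd c) * g A c))"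
    unfolding sum.distrib border_sum_def sum_distrib_left[symmetric] by (rule add.commute)
  finally show ?thesis by (simp only: sum_distrib_right)
qed

text \<open>For fixed \<open>b\<close> and \<open>w\<close>, the Schur complement
  \<open>A - b w\<close> runs through all matrices mod \<open>p\<close> as \<open>A\<close> does. So
  \<open>A\<close> is summed first, and there are \<open>p^r\<close> choices for each of
  \<open>b\<close> and \<open>w\<close>.\<close>

lemma sum_corner_1:
  "(\<Sum>A\<in>residue_mats p r r. \<Sum>w\<in>residue_mats p 1 r. \<Sum>b\<in>residue_mats p r 1.
    unit_det (bordered_mat A b w 1)) = int p ^ (2 * r) * gl_count r"
proof -
  have "(\<Sum>A\<in>residue_mats p r r. unit_det (bordered_mat A b w 1)) = gl_count r"
    if b: "b \<in> residue_mats p r 1" and w: "w \<in> residue_mats p 1 r" for b w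
  proof -
    have Z: "- (b * w) \<in> carrier_mat r r"
      using residue_matsD(1)[OF b] residue_matsD(1)[OF w] by auto
    have "unit_det (bordered_mat A b w 1) = unit_det (reduce_mat p (A + - (b * w)))"
      if A: "A \<in> residue_mats p r r" for A
    proof -
      have "A + - (b * w) \<in> carrier_mat r r" using residue_matsD(1)[OF A] Z by simp
      from det_reduce_mat_cong[OF this dvd_refl, of p] show ?thesis
        using det_bordered_mat_1[OF residue_matsD(1)[OF A] residue_matsD(1)[OF b] residue_matsD(1)[OF w]]
        by (simp add: unit_det_def cong_dvd_iff)
    qed
    hence "(\<Sum>A\<in>residue_mats p r r. unit_det (bordered_mat A b w 1)) =
        (\<Sum>A\<in>residue_mats p r r. unit_det (reduce_mat p (A + - (b * w))))" by simp
    also have "\<dots> = gl_count r"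
      unfolding gl_count_def
      by (rule sum.reindex_bij_betw[OF bij_betw_shift_residue_mats[OF prime_gt_0_nat[OF p] Z]])
    finally show ?thesis .
  qed
  hence "(\<Sum>w\<in>residue_mats p 1 r. \<Sum>b\<in>residue_mats p r 1. \<Sum>A\<in>residue_mats p r r.
      unit_det (bordered_mat A b w 1)) = int p ^ (2 * r) * gl_count r"
    by (simp add: card_residue_mats mult_2 power_add)
  also have "(\<Sum>w\<in>residue_mats p 1 r. \<Sum>b\<in>residue_mats p r 1. \<Sum>A\<in>residue_mats p r r.
      unit_det (bordered_mat A b w 1)) = (\<Sum>w\<in>residue_mats p 1 r. \<Sum>A\<in>residue_mats p r r.
      \<Sum>b\<in>residue_mats p r 1. unit_det (bordered_mat A b w 1))"
    by (intro sum.cong refl sum.swap)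
  also have "\<dots> = (\<Sum>A\<in>residue_mats p r r. \<Sum>w\<in>residue_mats p 1 r.
      \<Sum>b\<in>residue_mats p r 1. unit_det (bordered_mat A b w 1))"
    by (rule sum.swap)
  finally show ?thesis .
qed

text \<open>\<open>weighted_sum_bordered\<close> is used with two weights: the indicator of corner
  1, and the indicator of total trace \<open>t\<close>. Comparing the results eliminates
  \<open>border_sum\<close> without evaluating it.\<close>

lemma trace_count_Suc:
  "int (trace_count p (Suc r) t) = int p ^ (2 * r) * gl_count r - int p ^ r * int (trace_count p r t)"
proof -
  have pos: "p > 0" and p1: "p > 1" using p prime_gt_0_nat prime_gt_1_nat by auto
  have dvd0: "int p dvd c \<longleftrightarrow> c = 0" if "c \<in> {0..<int p}" for c
    using that zdvd_not_zless[of c "int p"] by (cases "c > 0") auto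
  have "(\<Sum>A\<in>residue_mats p r r. \<Sum>w\<in>residue_mats p 1 r. \<Sum>c\<in>{0..<int p}. \<Sum>b\<in>residue_mats p r 1.
      unit_det (bordered_mat A b w c) * of_bool (c = 1)) = int p ^ (2 * r) * gl_count r"
  proof -
    have "(\<Sum>c\<in>{0..<int p}. \<Sum>b\<in>residue_mats p r 1. unit_det (bordered_mat A b w c) * of_bool (c = 1)) =
        (\<Sum>b\<in>residue_mats p r 1. unit_det (bordered_mat A b w 1))" for A w
    proof -
      have "(\<Sum>c\<in>{0..<int p}. \<Sum>b\<in>residue_mats p r 1. unit_det (bordered_mat A b w c) * of_bool (c = 1)) =
        (\<Sum>c\<in>{0..<int p}. if c = 1 then \<Sum>b\<in>residue_mats p r 1. unit_det (bordered_mat A b w 1) else 0)"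
        by (intro sum.cong refl) simp
      also have "\<dots> = (\<Sum>b\<in>residue_mats p r 1. unit_det (bordered_mat A b w 1))"
        using p1 by (subst sum.delta) auto
      finally show ?thesis .
    qed
    thus ?thesis by (simp only: sum_corner_1)
  qed
  moreover have "(\<Sum>c\<in>{0..<int p}. of_bool (c = 1)) = (1::int)"
  proof -
    have "{0..<int p} \<inter> {c. c = 1} = {1}" using p1 by auto
    thus ?thesis by simp
  qed
  moreover have "(\<Sum>c\<in>{0..<int p}. of_bool (\<not> int p dvd c) * of_bool (c = 1)) = (1::int)"
  proof -
    have "(\<Sum>c\<in>{0..<int p}. of_bool (\<not> int p dvd c) * of_bool (c = 1)) =
        (\<Sum>c\<in>{0..<int p}. of_bool (c = 1) :: int)"
      by (intro sum.cong refl) (auto simp: dvd0)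
    thus ?thesis using \<open>(\<Sum>c\<in>{0..<int p}. of_bool (c = 1)) = (1::int)\<close> by metis
  qed
  ultimately have G: "int p ^ (2 * r) * gl_count r = border_sum r + int p ^ r * gl_count r"
    using weighted_sum_bordered[where r = r and g = "\<lambda>_ c. of_bool (c = 1)"] by (simp add: gl_count_def)
  have sum1: "(\<Sum>c\<in>{0..<int p}. of_bool [mat_trace A + c = t] (mod int p)) = (1::int)" for A
  proof -
    have "[mat_trace A + c = t] (mod int p) \<longleftrightarrow> [t - mat_trace A = c] (mod int p)" for c
      by (simp add: cong_iff_dvd_diff) (metis diff_diff_eq dvd_minus_iff minus_diff_eq)
    thus ?thesis by (simp only: sum_cong_residue[OF pos])
  qed
  \<comment> \<open>Only \<open>c = 0\<close> is divisible by \<open>p\<close> in this range, so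
    exactly the term where \<open>A\<close> alone has trace \<open>t\<close> is removed.\<close>
  have sum2: "(\<Sum>c\<in>{0..<int p}. of_bool (\<not> int p dvd c) * of_bool [mat_trace A + c = t] (mod int p)) =
      1 - (of_bool [mat_trace A = t] (mod int p) :: int)" for A
  proof -
    have "(\<Sum>c\<in>{0..<int p}. of_bool (\<not> int p dvd c) * of_bool [mat_trace A + c = t] (mod int p)) =
      (\<Sum>c\<in>{0..<int p}. of_bool [mat_trace A + c = t] (mod int p) -
        (if c = 0 then of_bool [mat_trace A = t] (mod int p) else 0) :: int)"
      by (intro sum.cong refl) (simp add: dvd0)
    also have "\<dots> = 1 - of_bool [mat_trace A = t] (mod int p)"
      using pos by (simp only: sum_subtractf sum1) (subst sum.delta, auto)
    finally show ?thesis .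
  qed
  have "int (trace_count p (Suc r) t) =
    (\<Sum>A\<in>residue_mats p r r. \<Sum>w\<in>residue_mats p 1 r. \<Sum>c\<in>{0..<int p}. \<Sum>b\<in>residue_mats p r 1.
      unit_det (bordered_mat A b w c) * of_bool [mat_trace A + c = t] (mod int p))"
    unfolding int_trace_count_prime sum_bordered_mat[OF pos]
    by (intro sum.cong refl) (simp only: mat_trace_bordered_mat[OF residue_matsD(1) residue_matsD(1) residue_matsD(1)])
  also have "\<dots> = border_sum r + int p ^ r * (\<Sum>A\<in>residue_mats p r r. unit_det A *
      (1 - of_bool [mat_trace A = t] (mod int p)))"
    using weighted_sum_bordered[where r = r, OF sum1] by (simp only: sum2)
  also have "(\<Sum>A\<in>residue_mats p r r. unit_det A * (1 - of_bool [mat_trace A = t] (mod int p))) =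
      gl_count r - int (trace_count p r t)"
    by (simp only: right_diff_distrib sum_subtractf int_trace_count_prime gl_count_def mult_1_right)
  finally show ?thesis using G by (simp add: algebra_simps)
qed

text \<open>Sum of \<open>trace_count_Suc\<close> over the \<open>p\<close> residues
  \<open>t\<close>; the first term is constant in \<open>t\<close>, and the traces in the second add
  up to \<open>gl_count r\<close>.\<close>

lemma gl_count_Suc: "gl_count (Suc r) = int p ^ r * (int p ^ Suc r - 1) * gl_count r"
proof -
  have "gl_count (Suc r) = int p * (int p ^ (2 * r) * gl_count r) - int p ^ r * gl_count r"
    by (simp add: gl_count_eq_sum[of "Suc r"] trace_count_Suc sum_subtractf sum_distrib_left[symmetric]
      gl_count_eq_sum[of r, symmetric])
  thus ?thesis by (simp add: algebra_simps mult_2_right power_add)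
qed

section \<open>Closed forms over a prime modulus\<close>

lemma residue_mats_0: "residue_mats n 0 0 = {0\<^sub>m 0 0}"
  by (auto simp: residue_mats_def)

lemma gl_count_eq: "real_of_int (gl_count r) = real p ^ r\<^sup>2 * (\<Prod>i=1..r. 1 - 1 / real p ^ i)"
proof (induction r)
  case 0
  show ?case using prime_gt_1_nat[OF p] by (simp add: gl_count_def residue_mats_0 unit_det_def)
next
  case (Suc r)
  have pos: "real p > 0" using prime_gt_0_nat[OF p] by simp
  have e: "(Suc r)\<^sup>2 = r\<^sup>2 + r + Suc r" by (simp add: power2_eq_square)
  have "real p ^ r * (real p ^ Suc r - 1) = real p ^ r * real p ^ Suc r * (1 - 1 / real p ^ Suc r)"
    using pos by (simp add: field_simps)
  moreover have "real_of_int (gl_count (Suc r)) =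
      real p ^ r * (real p ^ Suc r - 1) * real_of_int (gl_count r)"
    by (simp add: gl_count_Suc)
  moreover have "(\<Prod>i=1..Suc r. 1 - 1 / real p ^ i) =
      (\<Prod>i=1..r. 1 - 1 / real p ^ i) * (1 - 1 / real p ^ Suc r)" by simp
  ultimately show ?case by (simp only: Suc.IH e power_add mult_ac)
qed

text \<open>The factor \<open>real p\<close> on the left avoids the exponent \<open>r^2 - 1\<close>,
  which truncated subtraction would spoil at the base case \<open>r = 0\<close>.\<close>

lemma trace_count_prime:
  "real p * real (trace_count p r t) = real p ^ r\<^sup>2 *
     ((\<Prod>i=1..r. 1 - 1 / real p ^ i) + (-1) ^ r * (1 / real p ^ (r * (r + 1) div 2)) *
       (if int p dvd t then real p - 1 else -1))"
proof (induction r)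
  case 0
  have "{X \<in> residue_mats p 0 0. coprime (det X) (int p) \<and> [mat_trace X = t] (mod int p)} =
      (if int p dvd t then {0\<^sub>m 0 0} else {})"
    by (auto simp: residue_mats_0 mat_trace_def cong_0_iff cong_sym_eq[of 0])
  thus ?case by (simp add: trace_count_def)
next
  case (Suc r)
  have pos: "real p > 0" using prime_gt_0_nat[OF p] by simp
  have e: "(Suc r)\<^sup>2 = r\<^sup>2 + r + Suc r" by (simp add: power2_eq_square)
  have e2: "Suc r * (Suc r + 1) div 2 = r * (r + 1) div 2 + Suc r" by simp
  have "real_of_int (int (trace_count p (Suc r) t)) =
      real p ^ (2 * r) * real_of_int (gl_count r) - real p ^ r * real (trace_count p r t)"
    unfolding trace_count_Suc by simp
  hence "real p * real (trace_count p (Suc r) t) = real p *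
      (real p ^ (2 * r) * real_of_int (gl_count r) - real p ^ r * real (trace_count p r t))" by simp
  also have "\<dots> = real p ^ (2 * r) * real p * real_of_int (gl_count r) -
      real p ^ r * (real p * real (trace_count p r t))"
    by (simp add: algebra_simps)
  \<comment> \<open>The product terms combine to the new factor \<open>1 - 1 / p^(r+1)\<close>. In
    the signed term both \<open>r^2 + r - r(r+1)/2\<close> and \<open>(r+1)^2 - (r+1)(r+2)/2\<close>
    equal \<open>r(r+1)/2\<close>.\<close>
  also have "\<dots> = real p ^ (Suc r)\<^sup>2 *
     ((\<Prod>i=1..Suc r. 1 - 1 / real p ^ i) + (-1) ^ Suc r * (1 / real p ^ (Suc r * (Suc r + 1) div 2)) *
       (if int p dvd t then real p - 1 else -1))"
    unfolding gl_count_eq Suc.IH e e2 power_add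
    using pos by (simp add: field_simps mult_2_right power_add)
  finally show ?case .
qed

end

section \<open>Assembly over the prime divisors of \<open>n\<close>\<close>

text \<open>Both kinds of local factor in one formula, so that the induction on \<open>n\<close>
  need not separate primes dividing \<open>t\<close> from the others.\<close>

definition trace_factor :: "nat \<Rightarrow> nat \<Rightarrow> int \<Rightarrow> real" where
  "trace_factor p r t = (\<Prod>i=1..r. 1 - 1 / real p ^ i) +
     (-1) ^ r * (1 / real p ^ (r * (r + 1) div 2)) * (if int p dvd t then real p - 1 else -1)"

text \<open>Induction removing one prime \<open>q\<close> from \<open>n = m * q\<close>. If
  \<open>q dvd m\<close>, lifting contributes a power of \<open>q\<close> and no new prime;
  otherwise the Chinese remainder theorem contributes the factor of \<open>q\<close>.\<close>

lemma trace_count_eq_prod: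
  assumes r: "r > 0" and "n > 0"
  shows "real (trace_count n r t) =
    real n ^ (r\<^sup>2 - 1) * (\<Prod>p\<in>{p. prime p \<and> p dvd n}. trace_factor p r t)"
  using \<open>n > 0\<close>
proof (induction n rule: less_induct)
  case (less n)
  show ?case
  proof (cases "n = 1")
    case True
    hence "{p. prime p \<and> p dvd n} = {}" by auto
    hence "(\<Prod>p\<in>{p. prime p \<and> p dvd n}. trace_factor p r t) = 1" by (simp only: prod.empty)
    \<comment> \<open>Modulo 1 there is a single residue matrix, and it satisfies both
      conditions.\<close>
    thus ?thesis using True by (simp add: trace_count_def card_residue_mats)
  next
    case False
    then obtain q where q: "prime q" "q dvd n" using prime_factor_nat by blast
    then obtain m where n: "n = m * q" by (metis dvdE mult.commute)
    have m: "m > 0" and q0: "q > 0" using less.prems n by auto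
    have "m < n" using n m prime_gt_1_nat[OF q(1)] by simp
    from less.IH[OF this m] have IH: "real (trace_count m r t) =
      real m ^ (r\<^sup>2 - 1) * (\<Prod>p\<in>{p. prime p \<and> p dvd m}. trace_factor p r t)" .
    show ?thesis
    proof (cases "q dvd m")
      case True
      have "{p. prime p \<and> p dvd n} = {p. prime p \<and> p dvd m}"
        using True q(1) by (auto simp: n prime_dvd_mult_iff dest: primes_dvd_imp_eq)
      thus ?thesis
        using trace_count_mult_dvd[OF m q0 True r, of t]
        by (simp add: n IH power_mult_distrib power2_eq_square)
    next
      case False
      have primes: "{p. prime p \<and> p dvd n} = insert q {p. prime p \<and> p dvd m}"
        using q(1) by (auto simp: n prime_dvd_mult_iff dest: primes_dvd_imp_eq)
      have "real q * real (trace_count q r t) = real q * (real q ^ (r\<^sup>2 - 1) * trace_factor q r t)"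
        using trace_count_prime[OF q(1), of r t] r by (simp add: trace_factor_def power_eq_if[of _ "r\<^sup>2"])
      hence "real (trace_count q r t) = real q ^ (r\<^sup>2 - 1) * trace_factor q r t"
        using q0 by simp
      moreover have "coprime m q"
        using False q(1) by (metis coprime_commute prime_imp_coprime)
      hence "trace_count n r t = trace_count m r t * trace_count q r t"
        using trace_count_mult m q0 n by blast
      moreover have "(\<Prod>p\<in>{p. prime p \<and> p dvd n}. trace_factor p r t) =
          trace_factor q r t * (\<Prod>p\<in>{p. prime p \<and> p dvd m}. trace_factor p r t)"
        unfolding primes using m False by (subst prod.insert) auto
      moreover have "real n ^ (r\<^sup>2 - 1) = real m ^ (r\<^sup>2 - 1) * real q ^ (r\<^sup>2 - 1)"
        by (simp add: n power_mult_distrib)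
      ultimately show ?thesis by (simp only: of_nat_mult IH mult_ac)
    qed
  qed
qed

theorem theorem8:
  fixes n r l :: nat and \<beta> :: int
  assumes "n \<ge> 1" and "r \<ge> 1"
    and "l = nat (gcd (int n) \<beta>)"
  shows "real (card {X \<in> GL_residues n r. [mat_trace X = \<beta>] (mod int n)}) =
    real n ^ (r\<^sup>2 - 1) *
    (\<Prod>p \<in> {p. prime p \<and> p dvd l}.
       (\<Prod>i = 1..r. 1 - 1 / real p ^ i)
         + (-1) ^ r * (1 / real p ^ (r * (r + 1) div 2)) * (real p - 1)) *
    (\<Prod>p \<in> {p. prime p \<and> p dvd n \<and> \<not> p dvd l}.
       (\<Prod>i = 1..r. 1 - 1 / real p ^ i)
         - (-1) ^ r * (1 / real p ^ (r * (r + 1) div 2)))"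
proof -
  have n: "n > 0" and r: "r > 0" using assms(1,2) by auto
  \<comment> \<open>Hence for primes dividing \<open>n\<close>, the case distinction in
    \<open>trace_factor\<close> is whether \<open>p dvd l\<close>.\<close>
  have l: "p dvd l \<longleftrightarrow> p dvd n \<and> int p dvd \<beta>" for p
    by (simp add: assms(3) flip: int_dvd_int_iff)
  let ?A = "{p. prime p \<and> p dvd l}" and ?B = "{p. prime p \<and> p dvd n \<and> \<not> p dvd l}"
  have "{p. prime p \<and> p dvd n} = ?A \<union> ?B" by (auto simp: l)
  moreover have "finite ?A" "finite ?B"
    by (rule finite_subset[of _ "{p. p dvd n}"]; use n in \<open>auto simp: l\<close>)+
  ultimately have prod: "(\<Prod>p\<in>{p. prime p \<and> p dvd n}. trace_factor p r \<beta>) =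
      (\<Prod>p\<in>?A. trace_factor p r \<beta>) * (\<Prod>p\<in>?B. trace_factor p r \<beta>)"
    by (simp add: prod.union_disjoint disjoint_iff)
  have "card {X \<in> GL_residues n r. [mat_trace X = \<beta>] (mod int n)} = trace_count n r \<beta>"
    by (simp add: GL_residues_eq[OF n] trace_count_def conj_assoc)
  hence "real (card {X \<in> GL_residues n r. [mat_trace X = \<beta>] (mod int n)}) =
      real n ^ (r\<^sup>2 - 1) * ((\<Prod>p\<in>?A. trace_factor p r \<beta>) * (\<Prod>p\<in>?B. trace_factor p r \<beta>))"
    by (simp only: trace_count_eq_prod[OF r n] prod)
  also have "(\<Prod>p\<in>?A. trace_factor p r \<beta>) = (\<Prod>p\<in>?A. (\<Prod>i = 1..r. 1 - 1 / real p ^ i)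
         + (-1) ^ r * (1 / real p ^ (r * (r + 1) div 2)) * (real p - 1))"
    by (intro prod.cong refl) (simp add: trace_factor_def l)
  also have "(\<Prod>p\<in>?B. trace_factor p r \<beta>) = (\<Prod>p\<in>?B. (\<Prod>i = 1..r. 1 - 1 / real p ^ i)
         - (-1) ^ r * (1 / real p ^ (r * (r + 1) div 2)))"
    by (intro prod.cong refl) (auto simp: trace_factor_def l)
  finally show ?thesis by (simp only: mult.assoc)
qed

end
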